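(* Let $K=(AP,S,R,S_0,I)$ be a Kripke structure and $x\notin AP$ an atomic proposition, and let $K'=(AP\cup\{x\},S',R',S'_0,I')$ be a Kripke structure that is $\{x\}$-bisimilar to $K$. Then $K'$ is simulated by the parallel synchronous composition $K\,\|\,\mathcal{X}$.
   Context: Here a Kripke structure $(AP,S,R,S_0,I)$ has atomic propositions $AP$, finite states $S$, total transition relation $R\subseteq S\times S$, a set $S_0\subseteq S$ of initial states, and labeling $I$ (write $I(s,p)\in\{\mathsf{true},\mathsf{false}\}$ for the value of $p$ at $s$). $\mathcal{X}=(\{x\},\{0,1\},\{0,1\},\{0,1\}\times\{0,1\},I^{\mathcal{X}})$ with $I^{\mathcal{X}}(0,x)=\mathsf{false}$, $I^{\mathcal{X}}(1,x)=\mathsf{true}$ (two states, both initial, all transitions). The parallel synchronous composition $K\|\mathcal{X}$ has atomic propositions $AP\cup\{x\}$, states $S\times\{0,1\}$, initial states $S_0\times\{0,1\}$, transitions $(\langle s,i\rangle,\langle t,j\rangle)$ iff $R(s,t)$, and labeling that agrees with $I(s)$ on $AP$ and with $I^{\mathcal{X}}(i)$ on $x$. $K'$ is $\{x\}$-bisimilar to $K$ iff its atomic propositions are $AP\cup\{x\}$ and there is a bisimulation w.r.t. $AP$ between $K$ and $K'$, i.e., a relation $\rho\subseteq S\times S'$ such that related states agree on $AP$, each transition of one of two related states is matched by a transition of the other to a related state (in both directions), and the initial states correspond (every initial state of each is related to some initial state of the other). A structure $M$ simulates $M'$ if there is a relation $\sigma$ between states of $M$ and $M'$ such that $\sigma(u,u')$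 implies $u,u'$ agree on all common atomic propositions and every successor $t'$ of $u'$ has a successor $t$ of $u$ with $\sigma(t,t')$, and every initial state of $M'$ is related to some initial state of $M$. *)

theory Defs
  imports Main
begin

text \<open>Only the values of \<open>label s p\<close> with \<open>s\<close> a state and \<open>p\<close> an atomic proposition are meaningful.\<close>

record ('p, 's) kripke =
  props :: "'p set"
  states :: "'s set"
  trans_rel :: "('s \<times> 's) set"
  init :: "'s set"
  label :: "'s \<Rightarrow> 'p \<Rightarrow> bool"

definition kripke_structure :: "('p, 's) kripke \<Rightarrow> bool" where
  "kripke_structure K \<longleftrightarrow>
     finite (states K) \<and>
     trans_rel K \<subseteq> states K \<times> states K \<and>
     (\<forall>s\<in>states K. \<exists>t. (s, t) \<in> trans_rel K) \<and>
     init K \<subseteq> states K"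

definition agree_on :: "'p set \<Rightarrow> ('p, 's) kripke \<Rightarrow> 's \<Rightarrow> ('p, 't) kripke \<Rightarrow> 't \<Rightarrow> bool" where
  "agree_on A K s L t \<longleftrightarrow> (\<forall>p\<in>A. label K s p = label L t p)"

definition bisimulation_wrt ::
  "'p set \<Rightarrow> ('p, 's) kripke \<Rightarrow> ('p, 't) kripke \<Rightarrow> ('s \<times> 't) set \<Rightarrow> bool" where
  "bisimulation_wrt A K K' \<rho> \<longleftrightarrow>
     \<rho> \<subseteq> states K \<times> states K' \<and>
     (\<forall>s s'. (s, s') \<in> \<rho> \<longrightarrow>
        agree_on A K s K' s' \<and>
        (\<forall>t. (s, t) \<in> trans_rel K \<longrightarrow> (\<exists>t'. (s', t') \<in> trans_rel K' \<and> (t, t') \<in> \<rho>)) \<and>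
        (\<forall>t'. (s', t') \<in> trans_rel K' \<longrightarrow> (\<exists>t. (s, t) \<in> trans_rel K \<and> (t, t') \<in> \<rho>))) \<and>
     (\<forall>s\<in>init K. \<exists>s'\<in>init K'. (s, s') \<in> \<rho>) \<and>
     (\<forall>s'\<in>init K'. \<exists>s\<in>init K. (s, s') \<in> \<rho>)"

text \<open>\<open>ext_bisimilar Y K K'\<close>: the structure \<open>K'\<close> is \<open>Y\<close>-bisimilar to \<open>K\<close>.\<close>

definition ext_bisimilar :: "'p set \<Rightarrow> ('p, 's) kripke \<Rightarrow> ('p, 't) kripke \<Rightarrow> bool" where
  "ext_bisimilar Y K K' \<longleftrightarrow>
     props K' = props K \<union> Y \<and> (\<exists>\<rho>. bisimulation_wrt (props K) K K' \<rho>)"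

text \<open>\<open>simulates M M'\<close>: the structure \<open>M\<close> simulates \<open>M'\<close>, i.e. \<open>M'\<close> is simulated by \<open>M\<close>.\<close>

definition simulates :: "('p, 's) kripke \<Rightarrow> ('p, 't) kripke \<Rightarrow> bool" where
  "simulates M M' \<longleftrightarrow>
     (\<exists>\<sigma> \<subseteq> states M \<times> states M'.
        (\<forall>u u'. (u, u') \<in> \<sigma> \<longrightarrow>
           agree_on (props M \<inter> props M') M u M' u' \<and>
           (\<forall>t'. (u', t') \<in> trans_rel M' \<longrightarrow> (\<exists>t. (u, t) \<in> trans_rel M \<and> (t, t') \<in> \<sigma>))) \<and>
        (\<forall>u'\<in>init M'. \<exists>u\<in>init M. (u, u') \<in> \<sigma>))"

text \<open>Parallel synchronous composition of structures with disjoint sets of atomic propositions;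
  without disjointness the state space would have to be restricted to pairs with matching labels.\<close>

definition par_comp :: "('p, 's) kripke \<Rightarrow> ('p, 't) kripke \<Rightarrow> ('p, 's \<times> 't) kripke" where
  "par_comp K L = \<lparr>
     props = props K \<union> props L,
     states = states K \<times> states L,
     trans_rel = {((s, i), (t, j)) | s i t j. (s, t) \<in> trans_rel K \<and> (i, j) \<in> trans_rel L},
     init = init K \<times> init L,
     label = (\<lambda>(s, i) p. if p \<in> props K then label K s p else label L i p)\<rparr>"

definition free_var :: "'p \<Rightarrow> ('p, nat) kripke" where
  "free_var x = \<lparr>
     props = {x},
     states = {0, 1},
     trans_rel = {0, 1} \<times> {0, 1},
     init = {0, 1},
     label = (\<lambda>i p. p = x \<and> i = 1)\<rparr>"

lemma kripke_structure_free_var: "kripke_structure (free_var x)"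
  by (auto simp: kripke_structure_def free_var_def)

lemma kripke_structure_par_comp:
  assumes "kripke_structure K" and "kripke_structure L"
  shows "kripke_structure (par_comp K L)"
proof -
  have "\<exists>u. (v, u) \<in> trans_rel (par_comp K L)" if v_state: "v \<in> states (par_comp K L)" for v
  proof -
    obtain s i where v: "v = (s, i)" "s \<in> states K" "i \<in> states L"
      using v_state by (auto simp: par_comp_def)
    then obtain t j where "(s, t) \<in> trans_rel K" "(i, j) \<in> trans_rel L"
      using assms unfolding kripke_structure_def by blast
    then have "(v, (t, j)) \<in> trans_rel (par_comp K L)"
      by (simp add: par_comp_def v)
    then show ?thesis ..
  qed
  moreover have "trans_rel (par_comp K L) \<subseteq> states (par_comp K L) \<times> states (par_comp K L)"
    using assms by (auto simp: kripke_structure_def par_comp_def)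
  moreover have "finite (states (par_comp K L))" "init (par_comp K L) \<subseteq> states (par_comp K L)"
    using assms by (auto simp: kripke_structure_def par_comp_def)
  ultimately show ?thesis
    by (simp add: kripke_structure_def)
qed

end

theory Submission
  imports Defs
begin

text \<open>A bisimulation \<open>\<rho>\<close> between \<open>K\<close> and \<open>K'\<close>
  controls everything except \<open>x\<close>, and the second component of the composition can take
  any value at any time. Pairing \<open>s\<close> with the value of \<open>x\<close> at a related
  \<open>s'\<close> therefore turns \<open>\<rho>\<close> into a simulation: \<open>\<rho>\<close>
  supplies agreement on \<open>props K\<close> and the matching moves in \<open>K\<close>, while the
  free component follows \<open>x\<close>.\<close>

theorem theorem4p7:
  fixes K :: "('p, 's) kripke" and K' :: "('p, 't) kripke" and x :: 'p
  assumes "kripke_structure K"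
    and "x \<notin> props K"
    and "kripke_structure K'"
    and "ext_bisimilar {x} K K'"
  shows "simulates (par_comp K (free_var x)) K'"
proof -
  let ?M = "par_comp K (free_var x)"
  obtain \<rho> where props: "props K' = props K \<union> {x}"
    and bisim: "bisimulation_wrt (props K) K K' \<rho>"
    using assms(4) by (auto simp: ext_bisimilar_def)
  have \<rho>_states: "\<rho> \<subseteq> states K \<times> states K'"
    and \<rho>_agree: "\<And>s s'. (s, s') \<in> \<rho> \<Longrightarrow> agree_on (props K) K s K' s'"
    and \<rho>_step: "\<And>s s' t'. (s, s') \<in> \<rho> \<Longrightarrow> (s', t') \<in> trans_rel K' \<Longrightarrow>
      \<exists>t. (s, t) \<in> trans_rel K \<and> (t, t') \<in> \<rho>"
    and \<rho>_init: "\<And>s'. s' \<in> init K' \<Longrightarrow> \<exists>s\<in>init K. (s, s') \<in> \<rho>"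
    using bisim unfolding bisimulation_wrt_def by blast+
  \<comment> \<open>All moves are allowed in \<open>free_var x\<close>, so its component can copy the value of \<open>x\<close> in \<open>K'\<close>.\<close>
  define val where "val s' = (of_bool (label K' s' x) :: nat)" for s'
  define \<sigma> where "\<sigma> = {((s, val s'), s') | s s'. (s, s') \<in> \<rho>}"
  have val_01: "val s' = 0 \<or> val s' = Suc 0" for s'
    by (simp add: val_def)
  have "\<sigma> \<subseteq> states ?M \<times> states K'"
    using \<rho>_states by (auto simp: \<sigma>_def par_comp_def free_var_def val_def)
  \<comment> \<open>Labels in \<open>par_comp\<close> come from \<open>K\<close> on
    \<open>props K\<close>; since \<open>x \<notin> props K\<close>, the value of \<open>x\<close>
    is read from the second component, which is \<open>val u'\<close>.\<close>
  moreover have "agree_on (props ?M \<inter> props K') ?M u K' u'" if "(u, u') \<in> \<sigma>" for u u'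
    using that \<rho>_agree assms(2) props
    by (auto simp: \<sigma>_def agree_on_def par_comp_def free_var_def val_def of_bool_def split: if_splits)
  moreover have "\<exists>t. (u, t) \<in> trans_rel ?M \<and> (t, t') \<in> \<sigma>"
    if related: "(u, u') \<in> \<sigma>" and step: "(u', t') \<in> trans_rel K'" for u u' t'
  proof -
    obtain s where u: "u = (s, val u')" and s: "(s, u') \<in> \<rho>"
      using related by (auto simp: \<sigma>_def)
    obtain t where "(s, t) \<in> trans_rel K" "(t, t') \<in> \<rho>"
      using \<rho>_step[OF s step] by blast
    \<comment> \<open>The second component jumps to the value of \<open>x\<close> at the target
      \<open>t'\<close>, whatever \<open>val u'\<close> was.\<close>
    then have "(u, (t, val t')) \<in> trans_rel ?M \<and> ((t, val t'), t') \<in> \<sigma>"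
      using val_01[of u'] val_01[of t'] by (auto simp: u \<sigma>_def par_comp_def free_var_def)
    then show ?thesis ..
  qed
  moreover have "\<exists>u\<in>init ?M. (u, u') \<in> \<sigma>" if "u' \<in> init K'" for u'
  proof -
    obtain s where "s \<in> init K" "(s, u') \<in> \<rho>"
      using \<rho>_init[OF \<open>u' \<in> init K'\<close>] by blast
    \<comment> \<open>Both states of \<open>free_var x\<close> are initial, so the right value of
      \<open>x\<close> is available from the start.\<close>
    then have "((s, val u'), u') \<in> \<sigma>" "(s, val u') \<in> init ?M"
      using val_01[of u'] by (auto simp: \<sigma>_def par_comp_def free_var_def)
    then show ?thesis ..
  qed
  ultimately show ?thesis
    unfolding simulates_def by (intro exI[of _ \<sigma>]) simp
qed

end
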